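(* For all natural numbers $a, b \geq 1$, $$\gcd(a,b) = \left( \left\lfloor \frac{5^{ab(ab+a+b)}}{(5^{a^2 b}-1)(5^{ab^2}-1)} \right\rfloor \bmod 5^{ab} \right) - 1.$$
   Context: $\gcd(a,b)$ denotes the greatest common divisor of $a$ and $b$. For integers $x$ and $m \geq 1$, $x \bmod m$ denotes the least non-negative residue of $x$ modulo $m$, i.e. the unique $r \in \{0,\dots,m-1\}$ with $m \mid x - r$; $\lfloor \cdot \rfloor$ is the floor function. *)

theory Defs
  imports Complex_Main
begin

end

theory Submission
  imports Defs "HOL-Number_Theory.Cong"
begin

text \<open>
  With \<open>Q = 5 ^ (a * b)\<close> the quotient is the sum of \<open>Q ^ (a * b - i * a - j * b)\<close> over all
  \<open>i, j \<ge> 0\<close>. Terms with positive exponent are multiples of \<open>Q\<close>, terms with negative exponent add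
  up to less than 1, and exponent 0 occurs once for every \<open>i \<le> b\<close> with \<open>b dvd i * a\<close>, that
  is, \<open>gcd a b + 1\<close> times. To keep all sums finite, the two geometric series are cut off at
  \<open>i = b\<close> and \<open>j = (a * b - i * a) div b\<close> and their remainders are kept in closed form.
\<close>

text \<open>Dividing by \<open>g = gcd a b\<close> leaves \<open>d = b div g\<close> coprime to
  \<open>c = a div g\<close>, so the condition becomes \<open>d dvd i\<close>. The multiples of
  \<open>d\<close> in \<open>{0..g * d}\<close> are \<open>d * k\<close> with
  \<open>k \<le> g\<close>; both endpoints count, hence the \<open>+ 1\<close>.\<close>

lemma card_dvd_mult_atMost:
  fixes a b :: nat
  assumes "b > 0"
  shows "card {i. i \<le> b \<and> b dvd i * a} = gcd a b + 1"
proof -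
  define g where "g = gcd a b"
  define d where "d = b div g"
  have g: "g > 0" and b: "b = g * d"
    using assms by (auto simp: g_def d_def)
  obtain c where a: "a = g * c"
    unfolding g_def by (meson dvdE gcd_dvd1)
  have d: "d > 0"
    using assms b by simp
  have "g * gcd c d = g"
    using a b g_def gcd_mult_distrib_nat by metis
  then have cop: "coprime d c"
    using g by (simp add: coprime_iff_gcd_eq_1 gcd.commute)
  have "b dvd i * a \<longleftrightarrow> d dvd i" for i
  proof -
    have "b dvd i * a \<longleftrightarrow> g * d dvd g * (i * c)"
      by (simp add: a b ac_simps)
    also have "\<dots> \<longleftrightarrow> d dvd i"
      using g cop by (simp add: coprime_dvd_mult_left_iff)
    finally show ?thesis .
  qed
  then have "{i. i \<le> b \<and> b dvd i * a} = (\<lambda>k. d * k) ` {..g}"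
    using d by (auto simp: b elim!: dvdE)
  moreover have "inj_on (\<lambda>k. d * k) {..g}"
    using d by (auto simp: inj_on_def)
  ultimately show ?thesis
    by (simp add: card_image g_def)
qed

text \<open>For \<open>v > 1\<close> the left side is the series of all powers of \<open>v\<close>
  with exponent at most \<open>n\<close>; \<open>1 / (v - 1)\<close> is the part with negative
  exponents.\<close>

lemma geometric_partial_sum:
  fixes v :: real
  assumes "v \<noteq> 1"
  shows "v ^ n * (v / (v - 1)) = (\<Sum>j\<le>n. v ^ j) + 1 / (v - 1)"
proof -
  have "(v - 1) * (\<Sum>j\<le>n. v ^ j) = v ^ Suc n - 1"
    using power_diff_1_eq[of v "Suc n"] by (simp only: lessThan_Suc_atMost)
  then show ?thesis
    using assms by (simp add: field_simps)
qed

text \<open>Splitting off \<open>c mod b\<close> separates the nonnegative exponents, whose sum is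
  an integer for integral \<open>Q\<close>, from a small remainder.\<close>

lemma power_times_geometric:
  fixes Q :: real
  assumes "Q ^ b \<noteq> 1"
  shows "Q ^ c * (Q ^ b / (Q ^ b - 1)) =
    Q ^ (c mod b) * (\<Sum>j\<le>c div b. (Q ^ b) ^ j) + Q ^ (c mod b) / (Q ^ b - 1)"
proof -
  have "Q ^ c = Q ^ (c mod b) * (Q ^ b) ^ (c div b)"
    by (simp flip: power_mult power_add)
  then have "Q ^ c * (Q ^ b / (Q ^ b - 1)) =
      Q ^ (c mod b) * ((Q ^ b) ^ (c div b) * (Q ^ b / (Q ^ b - 1)))"
    by simp
  then show ?thesis
    by (simp only: geometric_partial_sum[OF assms] distrib_left) simp
qed

text \<open>If \<open>b dvd c\<close>, the prefactor is 1 and only the term \<open>j = 0\<close>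
  survives modulo \<open>Q\<close>; otherwise \<open>Q\<close> divides the prefactor.\<close>

lemma power_times_partial_sum_cong:
  fixes Q :: int
  assumes "b > 0"
  shows "[Q ^ (c mod b) * (\<Sum>j\<le>c div b. (Q ^ b) ^ j) = (if b dvd c then 1 else 0)] (mod Q)"
proof (cases "b dvd c")
  case True
  have "(\<Sum>j\<le>n. (Q ^ b) ^ j) = 1 + Q ^ b * (\<Sum>j<n. (Q ^ b) ^ j)" for n
    by (simp add: sum.atMost_shift sum_distrib_left)
  moreover have "Q dvd Q ^ b"
    using assms by simp
  ultimately show ?thesis
    using True by (simp add: cong_iff_dvd_diff)
next
  case False
  then have "Q dvd Q ^ (c mod b)"
    by (intro dvd_power) (simp add: mod_greater_zero_iff_not_dvd)
  then show ?thesis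
    using False by (simp add: cong_0_iff)
qed

text \<open>The lower bound on \<open>Q\<close> serves twice: it keeps the fractional part below 1,
  and it makes \<open>gcd a b + 1\<close> its own residue modulo \<open>Q\<close>.\<close>

lemma floor_double_geometric_mod:
  fixes a b :: nat and Q :: int
  assumes "a > 0" and "b > 0" and Q: "Q \<ge> 4 * int (a * b) + 1"
  shows "\<lfloor>real_of_int Q ^ (a * b + a + b) / ((real_of_int Q ^ a - 1) * (real_of_int Q ^ b - 1))\<rfloor> mod Q
    = int (gcd a b) + 1"
proof -
  define R where "R = real_of_int Q"
  define c where "c i = a * b - i * a" for i
  \<comment> \<open>\<open>M\<close> will be the floor. In \<open>E\<close>, the sum holds the tails
    in \<open>j\<close> for each \<open>i \<le> b\<close>, and the last term is the tail
    \<open>i > b\<close> times the full series in \<open>j\<close>.\<close>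
  define M where "M = (\<Sum>i\<le>b. Q ^ (c i mod b) * (\<Sum>j\<le>c i div b. (Q ^ b) ^ j))"
  define E where "E = (\<Sum>i\<le>b. R ^ (c i mod b) / (R ^ b - 1)) + R ^ b / ((R ^ a - 1) * (R ^ b - 1))"
  have ab: "a * b \<ge> 1"
    using assms by simp
  have "real_of_int Q \<ge> real_of_int (4 * int (a * b) + 1)"
    using Q by (simp only: of_int_le_iff)
  then have R4: "R \<ge> 4 * real (a * b) + 1"
    by (simp add: R_def)
  moreover have "real (a * b) \<ge> 1"
    using ab by linarith
  ultimately have R5: "R \<ge> 5"
    by linarith
  have pow5: "R ^ n \<ge> 5" if "n > 0" for n
    using R5 power_increasing[of 1 n R] that by simp
  have u: "R ^ a \<ge> 5" and v: "R ^ b \<ge> 5"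
    using pow5 assms by auto

  have low: "R ^ (a * b) * (R ^ a / (R ^ a - 1)) = (\<Sum>i\<le>b. R ^ c i) + 1 / (R ^ a - 1)"
  proof -
    \<comment> \<open>Reversing the order of summation works because
      \<open>c i = (b - i) * a\<close>.\<close>
    have "(\<Sum>i\<le>b. (R ^ a) ^ i) = (\<Sum>i\<le>b. R ^ c i)"
      unfolding c_def using assms
      by (intro sum.reindex_bij_witness[of _ "\<lambda>i. b - i" "\<lambda>i. b - i"])
        (auto simp flip: power_mult simp: diff_mult_distrib2 mult.commute)
    then show ?thesis
      using geometric_partial_sum[of "R ^ a" b] u by (simp add: power_mult)
  qed
  have "R ^ (a * b + a + b) / ((R ^ a - 1) * (R ^ b - 1))
      = R ^ (a * b) * (R ^ a / (R ^ a - 1)) * (R ^ b / (R ^ b - 1))"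
    by (simp add: power_add)
  also have "\<dots> = (\<Sum>i\<le>b. R ^ c i * (R ^ b / (R ^ b - 1))) + R ^ b / ((R ^ a - 1) * (R ^ b - 1))"
    by (simp only: low distrib_right sum_distrib_right) simp
  also have "\<dots> = real_of_int M + E"
  proof -
    have "(\<Sum>i\<le>b. R ^ c i * (R ^ b / (R ^ b - 1)))
        = (\<Sum>i\<le>b. R ^ (c i mod b) * (\<Sum>j\<le>c i div b. (R ^ b) ^ j) + R ^ (c i mod b) / (R ^ b - 1))"
      using v by (intro sum.cong refl power_times_geometric) simp
    then show ?thesis
      by (simp add: sum.distrib M_def E_def R_def)
  qed
  finally have eq: "R ^ (a * b + a + b) / ((R ^ a - 1) * (R ^ b - 1)) = real_of_int M + E" .

  have "0 \<le> E"
    using u v R5 by (auto simp: E_def intro!: sum_nonneg add_nonneg_nonneg)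
  have "E < 1"
  proof -
    have "R ^ (c i mod b) / (R ^ b - 1) \<le> 1 / (R - 1)" for i
    proof -
      \<comment> \<open>The residue \<open>c i mod b\<close> is at most
        \<open>b - 1\<close>.\<close>
      have "R ^ (c i mod b) * (R - 1) \<le> R ^ (b - 1) * (R - 1)"
        using R5 assms by (intro mult_right_mono power_increasing) (auto simp: Suc_leI less_Suc_eq_le[symmetric])
      also have "\<dots> = R ^ b - R ^ (b - 1)"
        using assms by (cases b) (auto simp: algebra_simps)
      also have "\<dots> \<le> R ^ b - 1"
        using R5 by simp
      finally show ?thesis
        using R5 v by (simp add: field_simps)
    qed
    then have "(\<Sum>i\<le>b. R ^ (c i mod b) / (R ^ b - 1)) \<le> (\<Sum>i\<le>b. 1 / (R - 1))"
      by (intro sum_mono)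
    also have "\<dots> = (real b + 1) / (R - 1)"
      by simp
    also have "\<dots> \<le> 1 / 2"
    proof -
      have "real b \<le> real (a * b)"
        using assms by (simp only: of_nat_le_iff) simp
      then have "2 * (real b + 1) \<le> R - 1"
        using R4 \<open>real (a * b) \<ge> 1\<close> by argo
      then show ?thesis
        using R5 by (simp add: pos_divide_le_eq)
    qed
    finally have 1: "(\<Sum>i\<le>b. R ^ (c i mod b) / (R ^ b - 1)) \<le> 1 / 2" .
    \<comment> \<open>Both bounds come from powers of \<open>R\<close> being at least 5; the total
      is then at most \<open>1/2 + 5/16 < 1\<close>.\<close>
    have "R ^ b / (R ^ b - 1) \<le> 5 / 4"
      using v by (simp add: field_simps)
    moreover have "1 / (R ^ a - 1) \<le> 1 / 4"
      using u by (simp add: field_simps)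
    ultimately have "1 / (R ^ a - 1) * (R ^ b / (R ^ b - 1)) \<le> 1 / 4 * (5 / 4)"
      using u v by (intro mult_mono) auto
    then have "R ^ b / ((R ^ a - 1) * (R ^ b - 1)) \<le> 5 / 16"
      by simp
    with 1 show ?thesis
      unfolding E_def by linarith
  qed
  have floor: "\<lfloor>R ^ (a * b + a + b) / ((R ^ a - 1) * (R ^ b - 1))\<rfloor> = M"
    unfolding eq using \<open>0 \<le> E\<close> \<open>E < 1\<close> by (simp add: floor_eq_iff)

  \<comment> \<open>For \<open>i \<le> b\<close> the natural subtraction in \<open>c i\<close> does
    not truncate.\<close>
  have dvd_c: "b dvd c i \<longleftrightarrow> b dvd i * a" if "i \<le> b" for i
    using that unfolding c_def
    by (metis dvd_diffD1 dvd_diff_nat dvd_triv_right mult.commute mult_le_mono1)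
  have "[M = (\<Sum>i\<le>b. if b dvd c i then 1 else 0)] (mod Q)"
    unfolding M_def using assms by (intro cong_sum power_times_partial_sum_cong)
  also have "(\<Sum>i\<le>b. if b dvd c i then 1 else 0) = (\<Sum>i\<le>b. if b dvd i * a then 1 else 0 :: int)"
    using dvd_c by (intro sum.cong) auto
  also have "\<dots> = int (card {i. i \<le> b \<and> b dvd i * a})"
    by (simp flip: sum.inter_filter)
  also have "\<dots> = int (gcd a b) + 1"
    using assms by (simp add: card_dvd_mult_atMost)
  finally have "M mod Q = (int (gcd a b) + 1) mod Q"
    by (simp add: cong_def)
  moreover have "int (gcd a b) + 1 < Q"
  proof -
    have "gcd a b \<le> a * b"
      using ab by (intro dvd_imp_le) auto
    then have "int (gcd a b) \<le> int (a * b)"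
      by (simp only: of_nat_le_iff)
    then show ?thesis
      using Q ab by linarith
  qed
  ultimately show ?thesis
    using floor by (simp add: R_def)
qed

theorem theorem1:
  fixes a b :: nat
  assumes "a \<ge> 1" and "b \<ge> 1"
  shows "int (gcd a b) =
    \<lfloor>(5::real) ^ (a * b * (a * b + a + b)) / ((5 ^ (a\<^sup>2 * b) - 1) * (5 ^ (a * b\<^sup>2) - 1))\<rfloor> mod 5 ^ (a * b) - 1"
proof -
  \<comment> \<open>Writing 5 as \<open>1 + 4\<close> makes Bernoulli's inequality yield exactly the
    bound required of \<open>Q = 5 ^ (a * b)\<close>.\<close>
  have "1 + real (a * b) * 4 \<le> (1 + 4) ^ (a * b)"
    by (intro Bernoulli_inequality) simp
  then have "real_of_int (4 * int (a * b) + 1) \<le> real_of_int (5 ^ (a * b))"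
    by simp
  then have "4 * int (a * b) + 1 \<le> 5 ^ (a * b)"
    by (simp only: of_int_le_iff)
  then have "\<lfloor>real_of_int (5 ^ (a * b)) ^ (a * b + a + b) /
      ((real_of_int (5 ^ (a * b)) ^ a - 1) * (real_of_int (5 ^ (a * b)) ^ b - 1))\<rfloor> mod 5 ^ (a * b)
      = int (gcd a b) + 1"
    using assms by (intro floor_double_geometric_mod) auto
  moreover have "a * b * a = a\<^sup>2 * b" and "a * b * b = a * b\<^sup>2"
    by (simp_all add: power2_eq_square)
  ultimately show ?thesis
    by (simp flip: power_mult)
qed

end
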